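(* Let $s,t$ be positive integers with $t = cs$ for some positive integer $c$, and let $F$ be a gerechte framework of order $n = st$ in which every region is either an $s \times t$ rectangle or a $t \times s$ rectangle. Then $F$ is realizable.
   Context: A gerechte framework of order $n$ is a partition of the cells of an $n\times n$ array into $n$ regions, each containing $n$ cells. A latin square of order $n$ is an $n\times n$ array with symbols $1,\dots,n$ in which each symbol appears exactly once in each row and once in each column. A latin square realizes a gerechte framework if, when its cells are partitioned by the framework, each region contains each symbol exactly once; a framework with such a latin square is called realizable. A region is an $a\times b$ rectangle if it consists of the cells lying in some $a$ consecutive rows and some $b$ consecutive columns (height $a$, width $b$). *)

theory Defs
  imports Main "HOL-Library.Disjoint_Sets"
begin

text \<open>Cells are pairs (row, column), with rows, columns and symbols numbered from 1.\<close>

definition cells :: "nat \<Rightarrow> (nat \<times> nat) set" where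
  "cells n = {1..n} \<times> {1..n}"

definition gerechte_framework :: "nat \<Rightarrow> (nat \<times> nat) set set \<Rightarrow> bool" where
  "gerechte_framework n F \<longleftrightarrow>
     partition_on (cells n) F \<and> card F = n \<and> (\<forall>R\<in>F. card R = n)"

text \<open>The values of \<^term>\<open>L\<close> outside \<^term>\<open>cells n\<close> are irrelevant.\<close>

definition latin_square :: "nat \<Rightarrow> (nat \<times> nat \<Rightarrow> nat) \<Rightarrow> bool" where
  "latin_square n L \<longleftrightarrow>
     L ` cells n \<subseteq> {1..n} \<and>
     (\<forall>i\<in>{1..n}. \<forall>k\<in>{1..n}. \<exists>!j. j \<in> {1..n} \<and> L (i, j) = k) \<and>
     (\<forall>j\<in>{1..n}. \<forall>k\<in>{1..n}. \<exists>!i. i \<in> {1..n} \<and> L (i, j) = k)"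

definition realizes :: "nat \<Rightarrow> (nat \<times> nat \<Rightarrow> nat) \<Rightarrow> (nat \<times> nat) set set \<Rightarrow> bool" where
  "realizes n L F \<longleftrightarrow>
     (\<forall>R\<in>F. \<forall>k\<in>{1..n}. \<exists>!x. x \<in> R \<and> L x = k)"

definition realizable :: "nat \<Rightarrow> (nat \<times> nat) set set \<Rightarrow> bool" where
  "realizable n F \<longleftrightarrow> (\<exists>L. latin_square n L \<and> realizes n L F)"

text \<open>The first argument is the height (number of rows), the second the width.\<close>

definition is_rectangle :: "nat \<Rightarrow> nat \<Rightarrow> (nat \<times> nat) set \<Rightarrow> bool" where
  "is_rectangle a b R \<longleftrightarrow> (\<exists>i j. R = {i..<i + a} \<times> {j..<j + b})"

end

(* Corners of the regions lie on the grid of s x s blocks: a corner off this grid would lie strictly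
   inside the region covering the cell above it or to its left. Give block (I, J) the colour
   (I + J) mod c; a region consists of c consecutive blocks in a strip, so it meets every colour once.
   A block of colour k is filled with the symbols (k, p, q), p, q < s: its cell (a, b) gets
   p = a + J div c and q = b + I div c modulo s. *)

theory Submission
  imports Defs
begin

section \<open>The latin square\<close>

text \<open>The symbol (k, p, q) is coded as a number with lowest digit q, middle digit p, both in
  base s, and leading digit k < c, so the codes run from 0 to \<open>s * (s * c) - 1\<close>.
  Coordinates count from 0 here: block indices and positions inside a block are then plain
  \<open>div\<close> and \<open>mod\<close>.\<close>

definition block_fill :: "nat \<Rightarrow> nat \<Rightarrow> nat \<Rightarrow> nat \<Rightarrow> nat" where
  "block_fill s c x y =
     (y mod s + x div s div c) mod s
     + s * ((x mod s + y div s div c) mod s + s * ((x div s + y div s) mod c))"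

lemma add_mult_less:
  fixes q m s N :: nat
  assumes "q < s" "m < N"
  shows "q + s * m < s * N"
proof -
  have "q + s * m < s + s * m" using assms by simp
  also have "\<dots> = s * Suc m" by simp
  also have "\<dots> \<le> s * N" using assms by (intro mult_le_mono2) simp
  finally show ?thesis .
qed

lemma add_mult_eqD:
  fixes q q' m m' s :: nat
  assumes "q + s * m = q' + s * m'" "q < s" "q' < s"
  shows "q = q'" "m = m'"
proof -
  have "(q + s * m) mod s = (q' + s * m') mod s" "(q + s * m) div s = (q' + s * m') div s"
    using assms(1) by simp_all
  then show "q = q'" "m = m'" using assms(2,3) by simp_all
qed

lemma block_fill_less:
  assumes "s > 0" "c > 0"
  shows "block_fill s c x y < s * (s * c)"
  unfolding block_fill_def using assms by (intro add_mult_less) simp_all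

lemma block_fill_eqD:
  assumes "s > 0" "block_fill s c x y = block_fill s c x' y'"
  shows "(y mod s + x div s div c) mod s = (y' mod s + x' div s div c) mod s"
    "(x mod s + y div s div c) mod s = (x' mod s + y' div s div c) mod s"
    "(x div s + y div s) mod c = (x' div s + y' div s) mod c"
proof -
  note eq = assms(2)[unfolded block_fill_def]
  show "(y mod s + x div s div c) mod s = (y' mod s + x' div s div c) mod s"
    using add_mult_eqD(1)[OF eq] assms(1) by simp
  have eq2: "(x mod s + y div s div c) mod s + s * ((x div s + y div s) mod c)
    = (x' mod s + y' div s div c) mod s + s * ((x' div s + y' div s) mod c)"
    using add_mult_eqD(2)[OF eq] assms(1) by simp
  show "(x mod s + y div s div c) mod s = (x' mod s + y' div s div c) mod s"
    using add_mult_eqD(1)[OF eq2] assms(1) by simp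
  show "(x div s + y div s) mod c = (x' div s + y' div s) mod c"
    using add_mult_eqD(2)[OF eq2] assms(1) by simp
qed

lemma mod_add_left_inj:
  fixes a b d m :: nat
  assumes "(d + a) mod m = (d + b) mod m"
  shows "a mod m = b mod m"
proof -
  \<comment> \<open>In the integers d can be subtracted without truncation.\<close>
  have "(int d + int a) mod int m = (int d + int b) mod int m"
    using assms by (metis of_nat_add of_nat_mod)
  then have "int a mod int m = int b mod int m"
    by (metis add_diff_cancel_left' mod_diff_left_eq)
  then show ?thesis by (metis of_nat_eq_iff of_nat_mod)
qed

lemma mod_add_right_inj:
  fixes a b d m :: nat
  assumes "(a + d) mod m = (b + d) mod m"
  shows "a mod m = b mod m"
  by (rule mod_add_left_inj[of d]) (use assms in \<open>simp add: add.commute\<close>)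

text \<open>A window of m consecutive numbers meets each residue class once. Shifting by k moves the
  window to start at 0, where \<open>mod\<close> is the identity.\<close>

lemma mod_eq_in_interval:
  fixes a b k m :: nat
  assumes "a mod m = b mod m" "k \<le> a" "a < k + m" "k \<le> b" "b < k + m"
  shows "a = b"
proof -
  have "(k + (a - k)) mod m = (k + (b - k)) mod m" using assms by simp
  then have "(a - k) mod m = (b - k) mod m" by (rule mod_add_left_inj)
  moreover have "a - k < m" "b - k < m" using assms by auto
  ultimately show ?thesis using assms by simp
qed

lemma div_mod_eqD:
  fixes a b m :: nat
  assumes "a div m = b div m" "a mod m = b mod m"
  shows "a = b"
  using assms by (metis div_mult_mod_eq)

lemma div_div_less:
  fixes y s c :: nat
  assumes "y < s * (s * c)"
  shows "y div s div c < s"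
  using assms by (metis div_mult2_eq less_mult_imp_div_less mult.assoc mult.commute)

text \<open>With x fixed, the digit p yields J div c, where J = \<open>y div s\<close>: this
  quotient is below s, so reducing it modulo s loses nothing. The colour yields J mod c. Together
  they give J, and then q gives \<open>y mod s\<close>.\<close>

lemma block_fill_row_inj:
  assumes "s > 0" "y < s * (s * c)" "y' < s * (s * c)"
    and eq: "block_fill s c x y = block_fill s c x y'"
  shows "y = y'"
proof -
  note d = block_fill_eqD[OF assms(1) eq]
  have "y div s div c mod s = y' div s div c mod s"
    by (rule mod_add_left_inj[OF d(2)])
  then have "y div s div c = y' div s div c"
    using div_div_less[OF assms(2)] div_div_less[OF assms(3)] by simp
  moreover have "y div s mod c = y' div s mod c"
    by (rule mod_add_left_inj[OF d(3)])
  ultimately have "y div s = y' div s" by (rule div_mod_eqD)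
  moreover have "y mod s = y' mod s"
    using mod_add_right_inj[OF d(1)] by simp
  ultimately show ?thesis by (rule div_mod_eqD)
qed

text \<open>The transposed argument: with y fixed, q recovers the quotient of the block row by c,
  the colour recovers its remainder, and p recovers \<open>x mod s\<close>. This is why the shift in
  q depends on the block row and the shift in p on the block column.\<close>

lemma block_fill_column_inj:
  assumes "s > 0" "x < s * (s * c)" "x' < s * (s * c)"
    and eq: "block_fill s c x y = block_fill s c x' y"
  shows "x = x'"
proof -
  note d = block_fill_eqD[OF assms(1) eq]
  have "x div s div c mod s = x' div s div c mod s"
    by (rule mod_add_left_inj[OF d(1)])
  then have "x div s div c = x' div s div c"
    using div_div_less[OF assms(2)] div_div_less[OF assms(3)] by simp
  moreover have "x div s mod c = x' div s mod c"
    by (rule mod_add_right_inj[OF d(3)])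
  ultimately have "x div s = x' div s" by (rule div_mod_eqD)
  moreover have "x mod s = x' mod s"
    using mod_add_right_inj[OF d(2)] by simp
  ultimately show ?thesis by (rule div_mod_eqD)
qed

text \<open>Inside one block both shifts are constant, so p determines the row and q the column
  modulo s.\<close>

lemma block_fill_block_inj:
  assumes "s > 0" "x div s = x' div s" "y div s = y' div s"
    and eq: "block_fill s c x y = block_fill s c x' y'"
  shows "x = x' \<and> y = y'"
proof -
  note d = block_fill_eqD[OF assms(1) eq, unfolded assms(2,3)]
  have "x mod s = x' mod s" "y mod s = y' mod s"
    using mod_add_right_inj[OF d(2)] mod_add_right_inj[OF d(1)] by simp_all
  then show ?thesis using assms(2,3) div_mod_eqD by blast
qed

lemma div_in_interval:
  fixes x s k m :: nat
  assumes "s > 0" "s * k \<le> x" "x < s * k + s * m"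
  shows "k \<le> x div s" "x div s < k + m"
  using assms by (simp_all add: less_eq_div_iff_mult_less_eq div_less_iff_less_mult algebra_simps)

text \<open>The rectangle is a run of c consecutive blocks in one block row. Their colours are
  pairwise distinct, so equal symbols force the same block, and the previous lemmas finish inside
  it.\<close>

lemma block_fill_wide_inj:
  assumes "s > 0"
    and x: "s * i \<le> x" "x < s * i + s" "s * i \<le> x'" "x' < s * i + s"
    and y: "s * j \<le> y" "y < s * j + s * c" "s * j \<le> y'" "y' < s * j + s * c"
    and eq: "block_fill s c x y = block_fill s c x' y'"
  shows "x = x' \<and> y = y'"
proof (rule block_fill_block_inj[OF assms(1) _ _ eq])
  show xx: "x div s = x' div s"
    \<comment> \<open>Height s means a window of length 1 for the block row.\<close>
    using div_in_interval[of s i _ 1] assms(1) x by (metis Suc_eq_plus1 le_antisym less_Suc_eq_le mult.right_neutral)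
  have "y div s mod c = y' div s mod c"
    using block_fill_eqD(3)[OF assms(1) eq] xx mod_add_left_inj by metis
  then show "y div s = y' div s"
    by (rule mod_eq_in_interval[where k = j]) (use div_in_interval[OF assms(1)] y in blast)+
qed

lemma block_fill_tall_inj:
  assumes "s > 0"
    and x: "s * i \<le> x" "x < s * i + s * c" "s * i \<le> x'" "x' < s * i + s * c"
    and y: "s * j \<le> y" "y < s * j + s" "s * j \<le> y'" "y' < s * j + s"
    and eq: "block_fill s c x y = block_fill s c x' y'"
  shows "x = x' \<and> y = y'"
proof (rule block_fill_block_inj[OF assms(1) _ _ eq])
  show yy: "y div s = y' div s"
    using div_in_interval[of s j _ 1] assms(1) y by (metis Suc_eq_plus1 le_antisym less_Suc_eq_le mult.right_neutral)
  have "x div s mod c = x' div s mod c"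
    using block_fill_eqD(3)[OF assms(1) eq] yy mod_add_right_inj by metis
  then show "x div s = x' div s"
    by (rule mod_eq_in_interval[where k = i]) (use div_in_interval[OF assms(1)] x in blast)+
qed

text \<open>Counting makes an injection between finite sets of equal size a bijection. Hence for
  rows, columns and regions alike only injectivity remains to be proved.\<close>

lemma inj_on_imp_ex1:
  assumes "inj_on f A" "f ` A \<subseteq> {1..n}" "card A = n" "k \<in> {1..n}"
  shows "\<exists>!x. x \<in> A \<and> f x = (k::nat)"
proof -
  have "f ` A = {1..n}"
    using assms(1-3) by (intro card_subset_eq) (simp_all add: card_image)
  then show ?thesis using assms(1,4) by (metis imageE inj_onD)
qed

section \<open>Alignment of the regions\<close>

text \<open>Induction on \<open>i + j\<close>: the region covering the neighbouring cell above or to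
  the left has a corner with smaller sum, so that corner is aligned. Its sides are multiples of s,
  so its far edges lie on the grid as well, and one of them bounds the present rectangle. The sides
  stay arbitrary in the induction because the neighbour may have another shape.\<close>

lemma rectangle_corners_aligned:
  assumes part: "partition_on (cells n) F"
    and rect: "\<And>R. R \<in> F \<Longrightarrow> \<exists>a b. s dvd a \<and> s dvd b \<and> is_rectangle a b R"
    and "{i..<i + a} \<times> {j..<j + b} \<in> F" "a > 0" "b > 0"
  shows "s dvd i - 1 \<and> s dvd j - 1"
  using assms(3-5)
proof (induction "i + j" arbitrary: i j a b rule: less_induct)
  case less
  let ?R = "{i..<i + a} \<times> {j..<j + b}"
  have ij: "(i, j) \<in> ?R" using less.prems by simp
  then have cell: "(i, j) \<in> cells n" using part less.prems(1) unfolding partition_on_def by blast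
  \<comment> \<open>Common to both directions: (p, q) will be the cell directly above or directly to
    the left of (i, j).\<close>
  have covering: thesis
    if "(p, q) \<in> cells n" "p + q < i + j" "p \<le> i" "q \<le> j"
      and step: "\<And>i' j' a' b'. \<lbrakk>s dvd i' - 1; s dvd j' - 1; s dvd a'; s dvd b'; i' \<ge> 1; j' \<ge> 1;
        i' \<le> p; p < i' + a'; j' \<le> q; q < j' + b';
        \<not> (i < i' + a' \<and> j < j' + b')\<rbrakk> \<Longrightarrow> thesis" for p q thesis
  proof -
    obtain R' where R': "R' \<in> F" "(p, q) \<in> R'"
      using part \<open>(p, q) \<in> cells n\<close> by (auto simp: partition_on_def)
    obtain a' b' i' j' where d: "s dvd a'" "s dvd b'" and R'_eq: "R' = {i'..<i' + a'} \<times> {j'..<j' + b'}"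
      using rect[OF R'(1)] unfolding is_rectangle_def by blast
    have pq: "i' \<le> p" "p < i' + a'" "j' \<le> q" "q < j' + b'" using R'(2) R'_eq by auto
    \<comment> \<open>The induction hypothesis applies since i' + j' \<le> p + q < i + j.\<close>
    have "s dvd i' - 1 \<and> s dvd j' - 1"
      using less.hyps[of i' j' a' b'] R'(1) R'_eq pq that(2) by auto
    moreover have "(i', j') \<in> R'" using pq R'_eq by auto
    then have "(i', j') \<in> cells n" using part R'(1) unfolding partition_on_def by blast
    then have "i' \<ge> 1" "j' \<ge> 1" by (auto simp: cells_def)
    \<comment> \<open>Otherwise \<open>R'\<close> would contain (i, j) and by disjointness equal
      \<open>?R\<close>, whose cells all have coordinate sum at least i + j, unlike (p, q).\<close>
    moreover have "\<not> (i < i' + a' \<and> j < j' + b')"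
    proof
      assume "i < i' + a' \<and> j < j' + b'"
      then have "(i, j) \<in> R'" using pq that(3,4) R'_eq by auto
      then have "R' = ?R"
        using disjointD[OF partition_onD2[OF part] R'(1) less.prems(1)] ij by blast
      then show False using R'(2) that(2) by auto
    qed
    ultimately show thesis
      by (intro step[of i' j' a' b'] d pq) simp_all
  qed
  have "s dvd i - 1"
  proof (cases "i = 1")
    case False
    then have "(i - 1, j) \<in> cells n" "i \<ge> 2" using cell by (auto simp: cells_def)
    then show ?thesis
    proof (rule_tac covering[of "i - 1" j])
      fix i' j' a' b' :: nat
      assume h: "s dvd i' - 1" "s dvd a'" "i' \<ge> 1" "i - 1 < i' + a'" "j < j' + b'"
        "\<not> (i < i' + a' \<and> j < j' + b')"
      \<comment> \<open>The covering region reaches column j, so it must stop before row i, that is,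
        exactly at row i - 1.\<close>
      then have "i - 1 = (i' - 1) + a'" by linarith
      then show ?thesis using h(1,2) by simp
    qed auto
  qed simp
  moreover have "s dvd j - 1"
  proof (cases "j = 1")
    case False
    then have "(i, j - 1) \<in> cells n" "j \<ge> 2" using cell by (auto simp: cells_def)
    then show ?thesis
    proof (rule_tac covering[of i "j - 1"])
      fix i' j' a' b' :: nat
      assume h: "s dvd j' - 1" "s dvd b'" "j' \<ge> 1" "j - 1 < j' + b'" "i < i' + a'"
        "\<not> (i < i' + a' \<and> j < j' + b')"
      then have "j - 1 = (j' - 1) + b'" by linarith
      then show ?thesis using h(1,2) by simp
    qed auto
  qed simp
  ultimately show ?case ..
qed

theorem theorem6:
  fixes s t c n :: nat and F :: "(nat \<times> nat) set set"
  assumes "s > 0" and "t > 0" and "c > 0"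
    and "t = c * s"
    and "n = s * t"
    and "gerechte_framework n F"
    and "\<forall>R\<in>F. is_rectangle s t R \<or> is_rectangle t s R"
  shows "realizable n F"
proof -
  have t: "t = s * c" and n: "n = s * (s * c)" using assms(4,5) by simp_all
  have part: "partition_on (cells n) F" and cardR: "\<And>R. R \<in> F \<Longrightarrow> card R = n"
    using assms(6) by (auto simp: gerechte_framework_def)
  \<comment> \<open>Subtracting 1 and applying \<open>Suc\<close> translate between cells and
    symbols counted from 1 and the zero-based \<open>block_fill\<close>.\<close>
  define L where "L = (\<lambda>(i, j). Suc (block_fill s c (i - 1) (j - 1)))"
  have L: "L (i, j) \<in> {1..n}" for i j
    using block_fill_less[OF assms(1,3), of "i - 1" "j - 1"] by (simp add: L_def n Suc_le_eq)
  have row: "inj_on (\<lambda>j. L (i, j)) {1..n}" for i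
  proof (rule inj_onI)
    fix j j' assume h: "j \<in> {1..n}" "j' \<in> {1..n}" "L (i, j) = L (i, j')"
    have "j - 1 = j' - 1"
      by (rule block_fill_row_inj[of s _ c _ "i - 1"]) (use assms(1) h in \<open>auto simp: L_def n\<close>)
    then show "j = j'" using h(1,2) by auto
  qed
  have column: "inj_on (\<lambda>i. L (i, j)) {1..n}" for j
  proof (rule inj_onI)
    fix i i' assume h: "i \<in> {1..n}" "i' \<in> {1..n}" "L (i, j) = L (i', j)"
    have "i - 1 = i' - 1"
      by (rule block_fill_column_inj[of s _ c _ "j - 1"]) (use assms(1) h in \<open>auto simp: L_def n\<close>)
    then show "i = i'" using h(1,2) by auto
  qed
  have inj: "inj_on L R" if "R \<in> F" for R
  proof -
    obtain a b i j where ab: "a = s \<and> b = t \<or> a = t \<and> b = s"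
      and R: "R = {i..<i + a} \<times> {j..<j + b}"
      using assms(7) \<open>R \<in> F\<close> unfolding is_rectangle_def by metis
    have pos: "a > 0" "b > 0" using ab assms(1,2) by auto
    have "s dvd i - 1 \<and> s dvd j - 1"
    proof (rule rectangle_corners_aligned[OF part, where a = a and b = b])
      \<comment> \<open>Both side lengths s and t = s * c are multiples of s.\<close>
      show "\<exists>a b. s dvd a \<and> s dvd b \<and> is_rectangle a b R" if "R \<in> F" for R
        using assms(7) that t by (meson dvd_refl dvd_triv_left)
    qed (use R \<open>R \<in> F\<close> pos in auto)
    then obtain i' j' where al: "i - 1 = s * i'" "j - 1 = s * j'" by (auto elim!: dvdE)
    \<comment> \<open>With truncated subtraction, \<open>i - 1 = s * i'\<close> alone would allow i
      = 0; the corner being a cell excludes this, and likewise for j.\<close>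
    have "(i, j) \<in> R" using pos R by simp
    then have "(i, j) \<in> cells n" using part \<open>R \<in> F\<close> unfolding partition_on_def by blast
    then have ij: "i = Suc (s * i')" "j = Suc (s * j')" using al by (auto simp: cells_def)
    show ?thesis
    proof (rule inj_onI, clarify)
      fix p q p' q' assume h: "(p, q) \<in> R" "(p', q') \<in> R" "L (p, q) = L (p', q')"
      have eq: "block_fill s c (p - 1) (q - 1) = block_fill s c (p' - 1) (q' - 1)"
        using h(3) by (simp add: L_def)
      have "p - 1 = p' - 1 \<and> q - 1 = q' - 1"
        using ab
      proof
        assume "a = s \<and> b = t"
        show ?thesis
          by (rule block_fill_wide_inj[OF assms(1) _ _ _ _ _ _ _ _ eq, of i' j'])
            (use h(1,2) \<open>a = s \<and> b = t\<close> in \<open>auto simp: R ij t\<close>)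
      next
        assume "a = t \<and> b = s"
        show ?thesis
          by (rule block_fill_tall_inj[OF assms(1) _ _ _ _ _ _ _ _ eq, of i' j'])
            (use h(1,2) \<open>a = t \<and> b = s\<close> in \<open>auto simp: R ij t\<close>)
      qed
      then show "p = p' \<and> q = q'" using h(1,2) by (auto simp: R ij)
    qed
  qed
  have "latin_square n L"
    unfolding latin_square_def
  proof (intro conjI ballI)
    show "L ` cells n \<subseteq> {1..n}" by (use L in auto)
    show "\<exists>!j. j \<in> {1..n} \<and> L (i, j) = k" if "k \<in> {1..n}" for i k
      by (rule inj_on_imp_ex1[OF row _ _ that]) (use L in auto)
    show "\<exists>!i. i \<in> {1..n} \<and> L (i, j) = k" if "k \<in> {1..n}" for j k
      by (rule inj_on_imp_ex1[OF column _ _ that]) (use L in auto)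
  qed
  moreover have "realizes n L F"
    unfolding realizes_def
  proof (intro ballI)
    fix R k assume "R \<in> F" "k \<in> {1..n}"
    show "\<exists>!x. x \<in> R \<and> L x = k"
      by (rule inj_on_imp_ex1[OF inj _ cardR]) (use L \<open>R \<in> F\<close> \<open>k \<in> {1..n}\<close> in auto)
  qed
  ultimately show ?thesis unfolding realizable_def by blast
qed

end
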